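(* Let $I_{c,n}:=\max\{I(K): K\text{ is a cap body in }\mathbb{E}^n\}$. For all $\alpha\in(0,\pi/2)$ we have $$I_{c,n}\le M(n,2\alpha)+N(n,\pi/2-\alpha).$$
   Context: $\mathbb{E}^n$ is $n$-dimensional Euclidean space, $\mathbb{B}^n$ its closed unit ball and $\mathbb{S}^{n-1}$ its unit sphere. For $x\in\mathbb{S}^{n-1}$ and $\beta\in(0,\pi)$, the open and closed spherical caps with center $x$ and angular radius $\beta$ are $C(x,\beta)=\{y\in\mathbb{S}^{n-1}: x\cdot y>\cos\beta\}$ and $C[x,\beta]=\{y\in\mathbb{S}^{n-1}: x\cdot y\ge\cos\beta\}$. For $0<\theta<\pi/2$, $N(n,\theta)$ is the smallest number of closed spherical caps of angular radius $\theta$ required to cover $\mathbb{S}^{n-1}$. For $0<\theta<\pi$, $M(n,\theta)$ is the maximal number of non-overlapping (pairwise disjoint) open spherical caps of $\mathbb{S}^{n-1}$ with angular radius $\theta/2$ (so their centers are $\theta$-separated in angular distance). For a compact $K\subset\mathbb{E}^n$, a boundary point $x$ of $K$ is illuminated by a direction $u\in\mathbb{S}^{n-1}$ if the half line originating at $x$ in the direction of $u$ intersects the interior of $K$ at points arbitrarily close to $x$. The illumination number $I(K)$ is the smallest number of directions needed to illuminate all boundary points of $K$ (each boundary point is illuminated by at least one of the directions). For points $x_1,\dots,x_m\in\mathbb{E}^n\setminus\mathbb{B}^n$ the spiky ball is $$\mathrm{Sp}[x_1,\dots,x_m]:=\bigcup_{i=1}^m \mathrm{conv}(\mathbb{B}^n\cup\{x_i\}),$$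 where $\mathrm{conv}$ is the convex hull; it is always assumed (without loss of generality) that each $x_i$ is a vertex, i.e., $\mathrm{Sp}[x_1,\dots,x_m]\neq \mathrm{Sp}[x_1,\dots,x_{i-1},x_{i+1},\dots,x_m]$. A cap body is a spiky ball which is a convex body (convex compact set with non-empty interior). *)

theory Defs
  imports "HOL-Analysis.Analysis" "HOL-Library.Extended_Nat"
begin

text \<open>
  The space \<open>\<bbbE>\<^sup>n\<close> is a type \<open>'a :: euclidean_space\<close> with \<open>n = DIM('a)\<close>. Quantities depending
  only on \<open>n\<close> take the type as a \<open>TYPE('a)\<close> argument. Smallest and largest cardinalities are
  infima and suprema in \<^typ>\<open>enat\<close>, so that they have no junk values.
\<close>

definition open_cap :: "'a::euclidean_space \<Rightarrow> real \<Rightarrow> 'a set" where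
  "open_cap x \<beta> = {y \<in> sphere 0 1. x \<bullet> y > cos \<beta>}"

definition closed_cap :: "'a::euclidean_space \<Rightarrow> real \<Rightarrow> 'a set" where
  "closed_cap x \<beta> = {y \<in> sphere 0 1. x \<bullet> y \<ge> cos \<beta>}"

definition cap_covering_number :: "'a::euclidean_space itself \<Rightarrow> real \<Rightarrow> enat" where
  "cap_covering_number _ \<theta> =
     (INF X \<in> {X :: 'a set. finite X \<and> X \<subseteq> sphere 0 1 \<and> sphere 0 1 \<subseteq> (\<Union>x\<in>X. closed_cap x \<theta>)}.
        enat (card X))"

definition cap_packing_number :: "'a::euclidean_space itself \<Rightarrow> real \<Rightarrow> enat" where
  "cap_packing_number _ \<theta> =
     (SUP X \<in> {X :: 'a set. finite X \<and> X \<subseteq> sphere 0 1 \<and>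
                 disjoint_family_on (\<lambda>x. open_cap x (\<theta> / 2)) X}.
        enat (card X))"

definition illuminates :: "'a::euclidean_space set \<Rightarrow> 'a \<Rightarrow> 'a \<Rightarrow> bool" where
  "illuminates K u x \<longleftrightarrow> (\<forall>\<epsilon>>0. \<exists>t\<ge>0. x + t *\<^sub>R u \<in> interior K \<and> dist (x + t *\<^sub>R u) x < \<epsilon>)"

definition illumination_number :: "'a::euclidean_space set \<Rightarrow> enat" where
  "illumination_number K =
     (INF U \<in> {U. finite U \<and> U \<subseteq> sphere 0 1 \<and> (\<forall>x \<in> frontier K. \<exists>u \<in> U. illuminates K u x)}.
        enat (card U))"

definition Sp :: "'a::euclidean_space set \<Rightarrow> 'a set" where
  "Sp X = (\<Union>x\<in>X. convex hull (cball 0 1 \<union> {x}))"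

text \<open>The points \<open>x\<^sub>1, \<dots>, x\<^sub>m\<close> form a set: the vertex condition excludes repetitions.\<close>

definition spiky_ball :: "'a::euclidean_space set \<Rightarrow> bool" where
  "spiky_ball K \<longleftrightarrow>
     (\<exists>X. finite X \<and> X \<noteq> {} \<and> X \<inter> cball 0 1 = {} \<and> (\<forall>x\<in>X. Sp X \<noteq> Sp (X - {x})) \<and> K = Sp X)"

definition cap_body :: "'a::euclidean_space set \<Rightarrow> bool" where
  "cap_body K \<longleftrightarrow> spiky_ball K \<and> convex K \<and> compact K \<and> interior K \<noteq> {}"

definition cap_body_illumination_number :: "'a::euclidean_space itself \<Rightarrow> enat" where
  "cap_body_illumination_number _ = (SUP K \<in> {K :: 'a set. cap_body K}. illumination_number K)"

text \<open>The covering and packing numbers are finite.\<close>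

lemma sphere_finite_net:
  assumes "0 < d"
  obtains Z :: "'a::euclidean_space set"
  where "finite Z" "Z \<subseteq> sphere 0 1" "sphere 0 1 \<subseteq> (\<Union>z\<in>Z. ball z d)"
proof -
  have "sphere 0 1 \<subseteq> (\<Union>z\<in>sphere (0::'a) 1. ball z d)"
    using assms centre_in_ball by blast
  then obtain Z :: "'a set" where "Z \<subseteq> sphere 0 1" "finite Z" "sphere 0 1 \<subseteq> (\<Union>z\<in>Z. ball z d)"
    using compactE_image[of "sphere (0::'a) 1" "sphere 0 1" "\<lambda>z. ball z d"] compact_sphere open_ball
    by blast
  then show thesis using that by blast
qed

lemma sphere_inner_gt:
  fixes x y :: "'a::euclidean_space"
  assumes "x \<in> sphere 0 1" "y \<in> sphere 0 1" "dist x y < 1 - cos \<beta>"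
  shows "x \<bullet> y > cos \<beta>"
proof -
  have "1 - x \<bullet> y = x \<bullet> (x - y)"
    using assms(1) by (simp add: inner_diff_right dot_square_norm)
  also have "\<dots> \<le> norm x * norm (x - y)"
    by (rule norm_cauchy_schwarz)
  also have "\<dots> = dist x y"
    using assms(1) by (simp add: dist_norm)
  finally show ?thesis using assms(3) by simp
qed

lemma one_minus_cos_pos: "0 < \<beta> \<Longrightarrow> \<beta> < pi \<Longrightarrow> 0 < 1 - cos \<beta>"
  using cos_monotone_0_pi[of 0 \<beta>] by simp

lemma cap_covering_number_finite:
  assumes "0 < \<theta>" "\<theta> < pi"
  shows "cap_covering_number TYPE('a::euclidean_space) \<theta> < \<infinity>"
proof -
  obtain Z :: "'a set" where Z: "finite Z" "Z \<subseteq> sphere 0 1"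
    and cov: "sphere 0 1 \<subseteq> (\<Union>z\<in>Z. ball z (1 - cos \<theta>))"
    using sphere_finite_net[OF one_minus_cos_pos[OF assms]] .
  have "sphere 0 1 \<subseteq> (\<Union>z\<in>Z. closed_cap z \<theta>)"
  proof
    fix y :: 'a assume y: "y \<in> sphere 0 1"
    then obtain z where "z \<in> Z" "dist z y < 1 - cos \<theta>" using cov by auto
    with y Z show "y \<in> (\<Union>z\<in>Z. closed_cap z \<theta>)"
      using sphere_inner_gt[of z y \<theta>] by (auto simp: closed_cap_def intro!: bexI[of _ z])
  qed
  then have "cap_covering_number TYPE('a) \<theta> \<le> enat (card Z)"
    unfolding cap_covering_number_def using Z by (intro INF_lower) auto
  then show ?thesis using enat_ord_simps(4) order_le_less_trans by blast
qed

lemma cap_packing_number_finite: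
  assumes "0 < \<theta>" "\<theta> < 2 * pi"
  shows "cap_packing_number TYPE('a::euclidean_space) \<theta> < \<infinity>"
proof -
  obtain Z :: "'a set" where Z: "finite Z" "Z \<subseteq> sphere 0 1"
    and cov: "sphere 0 1 \<subseteq> (\<Union>z\<in>Z. ball z (1 - cos (\<theta> / 2)))"
    using sphere_finite_net[OF one_minus_cos_pos[of "\<theta> / 2"]] assms by auto
  have "card X \<le> card Z"
    if X: "finite X" "X \<subseteq> sphere 0 1" "disjoint_family_on (\<lambda>x. open_cap x (\<theta> / 2)) X" for X :: "'a set"
  proof -
    have "\<forall>x\<in>X. \<exists>z\<in>Z. z \<in> open_cap x (\<theta> / 2)"
    proof
      fix x assume x: "x \<in> X"
      then obtain z where "z \<in> Z" "dist x z < 1 - cos (\<theta> / 2)"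
        using cov X(2) by (auto simp: dist_commute)
      with x X(2) Z show "\<exists>z\<in>Z. z \<in> open_cap x (\<theta> / 2)"
        using sphere_inner_gt[OF subsetD[OF X(2) x] subsetD[OF Z(2)], of z "\<theta> / 2"]
        by (auto simp: open_cap_def intro!: bexI[of _ z])
    qed
    then obtain f where f: "\<And>x. x \<in> X \<Longrightarrow> f x \<in> Z \<and> f x \<in> open_cap x (\<theta> / 2)"
      by metis
    then have "inj_on f X"
      using X(3) unfolding inj_on_def disjoint_family_on_def by (metis disjoint_iff)
    then show ?thesis
      using f Z(1) by (meson card_inj_on_le image_subsetI)
  qed
  then have "cap_packing_number TYPE('a) \<theta> \<le> enat (card Z)"
    unfolding cap_packing_number_def by (intro SUP_least) auto
  then show ?thesis using enat_ord_simps(4) order_le_less_trans by blast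
qed

end

theory Submission
  imports Defs
begin

text \<open>
  Let \<open>K = Sp X\<close> be a cap body, and split the vertices \<open>x\<close> of \<open>K\<close> by their distance from the
  origin. The tangent cone of the unit ball at apex \<open>x\<close> touches the ball in a cap of angular radius
  \<open>arccos (1 / norm x)\<close>; call \<open>x\<close> long if this radius is at least \<open>\<alpha>\<close>, that is, if
  \<open>norm x * cos \<alpha> \<ge> 1\<close>.

  Everything about illumination rests on one computation
  (\<open>illuminates_along_ray_into_ball\<close>): if the ray from \<open>x\<close> in direction \<open>u\<close> meets the open ball,
  then \<open>u\<close> illuminates every point \<open>(1 - t) b + t x\<close> with \<open>b\<close> in the ball and \<open>t > 0\<close>, since moving
  it along \<open>u\<close> only moves its \<open>x\<close>-part, and that ends in the open ball. So a direction is good for a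
  whole spike as soon as it points from the apex into the open ball.

  A long vertex is given its own direction, towards the origin. The open caps of radius \<open>\<alpha>\<close>
  around the long vertices are disjoint: a unit vector \<open>w\<close> in two of them would give a half space
  \<open>w \<bullet> z > 1\<close> that misses the ball and contains two vertices, which convexity of \<open>K\<close> excludes
  (\<open>vertices_not_in_common_half_space\<close>). Hence the packing number bounds the number of these
  directions. The remaining directions are the negatives of the centers of an optimal covering by
  caps of radius \<open>\<pi> / 2 - \<alpha>\<close>. At a vertex that is not long, the open ball is seen within an angle
  larger than \<open>\<pi> / 2 - \<alpha>\<close> around the direction to the origin, so one of them points into it; and at
  each point of the unit sphere one of them makes an acute angle with the inner normal.

  The resulting bound is finite and holds for all cap bodies, and a bounded nonempty set of extended
  natural numbers contains its supremum; therefore the supremum is a maximum.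
\<close>

section \<open>Illumination of convex bodies containing the unit ball\<close>

lemma convex_hull_cball_insert:
  "convex hull (cball 0 1 \<union> {x}) =
     {(1 - t) *\<^sub>R b + t *\<^sub>R x | b t. norm b \<le> 1 \<and> 0 \<le> t \<and> t \<le> 1}"
    (is "_ = ?R") for x :: "'a::euclidean_space"
proof -
  have "convex hull (cball 0 1 \<union> {x}) = convex hull (insert x (cball 0 1))"
    by simp
  also have "\<dots> = {u *\<^sub>R x + v *\<^sub>R b | u v b. 0 \<le> u \<and> 0 \<le> v \<and> u + v = 1 \<and> b \<in> cball 0 1}"
    by (subst convex_hull_insert) (auto simp: hull_same)
  also have "\<dots> = ?R"
  proof (intro set_eqI iffI)
    fix z assume "z \<in> {u *\<^sub>R x + v *\<^sub>R b | u v b. 0 \<le> u \<and> 0 \<le> v \<and> u + v = 1 \<and> b \<in> cball 0 1}"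
    then obtain u v b where *: "z = u *\<^sub>R x + v *\<^sub>R b" "0 \<le> u" "0 \<le> v" "u + v = 1" "norm b \<le> 1"
      by auto
    then have "v = 1 - u" by simp
    then have "z = (1 - u) *\<^sub>R b + u *\<^sub>R x" "u \<le> 1" using * by (simp_all add: add.commute)
    then show "z \<in> ?R" using * by blast
  next
    fix z assume "z \<in> ?R"
    then obtain b t where *: "z = (1 - t) *\<^sub>R b + t *\<^sub>R x" "norm b \<le> 1" "0 \<le> t" "t \<le> 1"
      by blast
    then have "z = t *\<^sub>R x + (1 - t) *\<^sub>R b" "0 \<le> 1 - t" "t + (1 - t) = 1" "b \<in> cball 0 1"
      by (simp_all add: add.commute)
    with * show "z \<in> {u *\<^sub>R x + v *\<^sub>R b | u v b. 0 \<le> u \<and> 0 \<le> v \<and> u + v = 1 \<and> b \<in> cball 0 1}"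
      by blast
  qed
  finally show ?thesis .
qed

text \<open>Convexity pushes one interior point on a ray arbitrarily close to the start of the ray.\<close>

lemma illuminatesI_convex:
  fixes K :: "'a::euclidean_space set"
  assumes "convex K" "z \<in> K" "0 < s" "z + s *\<^sub>R u \<in> interior K"
  shows "illuminates K u z"
  unfolding illuminates_def
proof (intro allI impI)
  fix \<epsilon> :: real assume \<epsilon>: "\<epsilon> > 0"
  define e where "e = min 1 (\<epsilon> / (2 * (s * norm u + 1)))"
  have pos: "0 < s * norm u + 1"
    using assms(3) by (smt (verit) mult_nonneg_nonneg norm_ge_zero)
  then have e: "0 < e" "e \<le> 1" "e * (s * norm u + 1) < \<epsilon>"
  proof -
    show "0 < e" "e \<le> 1" using pos \<epsilon> by (auto simp: e_def)
    have "e * (s * norm u + 1) \<le> \<epsilon> / (2 * (s * norm u + 1)) * (s * norm u + 1)"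
      using pos by (intro mult_right_mono) (auto simp: e_def)
    also have "\<dots> = \<epsilon> / 2" using pos by (simp add: field_simps)
    finally show "e * (s * norm u + 1) < \<epsilon>" using \<epsilon> by simp
  qed
  have "z - e *\<^sub>R (z - (z + s *\<^sub>R u)) \<in> interior K"
    using assms e closure_subset by (intro mem_interior_closure_convex_shrink) auto
  then have "z + (e * s) *\<^sub>R u \<in> interior K" by simp
  moreover have "dist (z + (e * s) *\<^sub>R u) z < \<epsilon>"
    using e assms(3) by (simp add: dist_norm algebra_simps)
  ultimately show "\<exists>t\<ge>0. z + t *\<^sub>R u \<in> interior K \<and> dist (z + t *\<^sub>R u) z < \<epsilon>"
    using e assms(3) by (intro exI[of _ "e * s"]) auto
qed

lemma ball_subset_interior_if_cball_subset:
  "cball 0 1 \<subseteq> K \<Longrightarrow> norm y < 1 \<Longrightarrow> y \<in> interior K" for y :: "'a::euclidean_space"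
  using interior_mono[of "cball 0 1" K] by auto

text \<open>
  If \<open>x + r u\<close> lies in the open ball, then so does \<open>(1 - t) b + t (x + r u)\<close>, by the triangle
  inequality. This is the point reached from \<open>(1 - t) b + t x\<close> after time \<open>t r\<close>, so the shape of the
  spike's boundary does not have to be known.
\<close>

lemma illuminates_along_ray_into_ball:
  fixes K :: "'a::euclidean_space set"
  assumes "convex K" "cball 0 1 \<subseteq> K"
    and z: "z \<in> K" "z = (1 - t) *\<^sub>R b + t *\<^sub>R x" "norm b \<le> 1" "0 < t" "t \<le> 1"
    and r: "0 < r" "norm (x + r *\<^sub>R u) < 1"
  shows "illuminates K u z"
proof (rule illuminatesI_convex)
  have "z + (t * r) *\<^sub>R u = (1 - t) *\<^sub>R b + t *\<^sub>R (x + r *\<^sub>R u)"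
    using z by (simp add: algebra_simps)
  also have "norm \<dots> \<le> (1 - t) * norm b + t * norm (x + r *\<^sub>R u)"
    using z norm_triangle_ineq[of "(1 - t) *\<^sub>R b" "t *\<^sub>R (x + r *\<^sub>R u)"] by simp
  also have "\<dots> < (1 - t) * 1 + t * 1"
    using z r by (intro add_le_less_mono mult_left_mono mult_strict_left_mono) auto
  finally show "z + (t * r) *\<^sub>R u \<in> interior K"
    using assms(2) by (intro ball_subset_interior_if_cball_subset) auto
qed (use assms in auto)

text \<open>
  The point of the ray from \<open>x\<close> that is nearest to the origin is reached at time \<open>- (x \<bullet> u)\<close>, and
  Pythagoras gives its norm.
\<close>

lemma ray_meets_ball:
  fixes x u :: "'a::euclidean_space"
  assumes "norm u = 1" "(norm x)\<^sup>2 - (x \<bullet> u)\<^sup>2 < 1"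
  shows "norm (x + (- (x \<bullet> u)) *\<^sub>R u) < 1"
proof -
  have "(norm (x + (- (x \<bullet> u)) *\<^sub>R u))\<^sup>2 = (norm x)\<^sup>2 - (x \<bullet> u)\<^sup>2"
    unfolding power2_norm_eq_inner using assms(1)
    by (simp add: inner_diff_left inner_diff_right inner_commute norm_eq_1 power2_eq_square[of "_ \<bullet> _"])
  with assms(2) show ?thesis
    by (smt (verit) one_le_power)
qed

lemma frontier_Sp_cases:
  fixes X :: "'a::euclidean_space set"
  assumes "compact (Sp X)" "X \<noteq> {}" "z \<in> frontier (Sp X)"
  obtains (ball) "norm z = 1"
  | (spike) x b t where "x \<in> X" "z = (1 - t) *\<^sub>R b + t *\<^sub>R x" "norm b \<le> 1" "0 < t" "t \<le> 1"
proof -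
  have "z \<in> Sp X"
    using assms by (meson compact_imp_closed frontier_subset_closed subsetD)
  then obtain x b t where *: "x \<in> X" "z = (1 - t) *\<^sub>R b + t *\<^sub>R x" "norm b \<le> 1" "0 \<le> t" "t \<le> 1"
    unfolding Sp_def convex_hull_cball_insert by blast
  have sub: "cball 0 1 \<subseteq> Sp X"
    unfolding Sp_def using assms(2) hull_subset[of "cball 0 1 \<union> {_::'a}" convex] by blast
  show thesis
  proof (cases "t = 0")
    case True
    with * have "norm z \<le> 1" by simp
    moreover have "\<not> norm z < 1"
      using ball_subset_interior_if_cball_subset[OF sub] assms(3) by (auto simp: frontier_def)
    ultimately show thesis by (intro ball) auto
  qed (use * spike in force)
qed

section \<open>Packing of the long vertices\<close>

lemma vertex_not_in_other_spike:
  fixes X :: "'a::euclidean_space set"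
  assumes "Sp X \<noteq> Sp (X - {y})" "x \<in> X" "x \<noteq> y"
  shows "y \<notin> convex hull (cball 0 1 \<union> {x})"
proof
  assume y: "y \<in> convex hull (cball 0 1 \<union> {x})"
  have "convex hull (cball 0 1 \<union> {y}) \<subseteq> convex hull (cball 0 1 \<union> {x})"
    using y hull_subset[of "cball 0 1 \<union> {x}" convex] by (intro hull_minimal) auto
  then have "Sp X = Sp (X - {y})"
    using assms(2,3) unfolding Sp_def by blast
  with assms(1) show False ..
qed

text \<open>
  Near the vertex \<open>x\<close> the segment from \<open>x\<close> to \<open>y\<close> runs in the spike of \<open>x\<close>, because the other spikes
  are closed and miss \<open>x\<close>. The line through \<open>x\<close> and such a point then meets the ball at some
  \<open>x + \<sigma> (y - x)\<close> with \<open>\<sigma> > 0\<close>. It cannot be between \<open>x\<close> and \<open>y\<close>, where the half space keeps the ball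
  away; hence \<open>\<sigma> > 1\<close>, and \<open>y\<close> lies in the spike of \<open>x\<close>, contrary to being a vertex.
\<close>

lemma vertices_not_in_common_half_space:
  fixes X :: "'a::euclidean_space set"
  assumes fin: "finite X" and conv: "convex (Sp X)"
    and vertex: "\<And>x. x \<in> X \<Longrightarrow> Sp X \<noteq> Sp (X - {x})"
    and xy: "x \<in> X" "y \<in> X" "x \<noteq> y"
    and w: "norm w = 1" "w \<bullet> x > 1" "w \<bullet> y > 1"
  shows False
proof -
  let ?S = "\<lambda>v. convex hull (cball 0 1 \<union> {v :: 'a})"
  have self: "v \<in> ?S v" for v
    by (simp add: hull_inc)
  have "x \<in> Sp X" "y \<in> Sp X"
    using xy self unfolding Sp_def by blast+
  define F where "F = (\<Union>v\<in>X - {x}. ?S v)"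
  have "compact (?S v)" for v
    by (intro compact_convex_hull compact_Un) auto
  then have "closed F"
    unfolding F_def using fin compact_imp_closed by (intro closed_UN) auto
  moreover have "x \<notin> F"
    unfolding F_def using vertex_not_in_other_spike[OF vertex] xy by blast
  ultimately obtain d where d: "0 < d" "ball x d \<subseteq> - F"
    using open_contains_ball[of "- F"] by auto
  define s where "s = min (1/2) (d / (2 * norm (y - x)))"
  have n: "norm (y - x) > 0" using xy by simp
  have s: "0 < s" "s < 1" using n d by (auto simp: s_def)
  define p where "p = x + s *\<^sub>R (y - x)"
  have "norm (p - x) = s * norm (y - x)" using s by (simp add: p_def)
  also have "\<dots> \<le> d / (2 * norm (y - x)) * norm (y - x)"
    by (intro mult_right_mono) (auto simp: s_def)
  also have "\<dots> < d" using n d by simp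
  finally have "p \<in> ball x d" by (simp add: dist_norm norm_minus_commute)
  with d have "p \<notin> F" by blast
  moreover have "p \<in> Sp X"
  proof -
    have "(1 - s) *\<^sub>R x + s *\<^sub>R y \<in> Sp X"
      using conv \<open>x \<in> Sp X\<close> \<open>y \<in> Sp X\<close> s by (intro convexD) auto
    then show ?thesis by (simp add: p_def algebra_simps)
  qed
  ultimately have "p \<in> ?S x" unfolding Sp_def F_def by blast
  then obtain b t where bt: "p = (1 - t) *\<^sub>R b + t *\<^sub>R x" "norm b \<le> 1" "0 \<le> t" "t \<le> 1"
    unfolding convex_hull_cball_insert by blast
  have "t \<noteq> 1"
    using bt(1) s n by (auto simp: p_def)
  with bt have t: "1 - t > 0" by simp
  define \<sigma> where "\<sigma> = s / (1 - t)"
  have \<sigma>: "\<sigma> > 0" using s t by (simp add: \<sigma>_def)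
  have "(1 - t) *\<^sub>R (b - x) = s *\<^sub>R (y - x)"
    using bt(1) by (simp add: p_def algebra_simps)
  then have "inverse (1 - t) *\<^sub>R (1 - t) *\<^sub>R (b - x) = inverse (1 - t) *\<^sub>R s *\<^sub>R (y - x)"
    by simp
  then have b: "b - x = \<sigma> *\<^sub>R (y - x)"
    using t by (simp add: \<sigma>_def divide_inverse mult.commute)
  have wb: "w \<bullet> b \<le> 1"
    using norm_cauchy_schwarz[of w b] w bt(2) by simp
  have wb': "w \<bullet> b = (1 - \<sigma>) * (w \<bullet> x) + \<sigma> * (w \<bullet> y)"
  proof -
    have "b = (1 - \<sigma>) *\<^sub>R x + \<sigma> *\<^sub>R y" using b by (simp add: algebra_simps)
    then show ?thesis by (simp add: inner_add_right)
  qed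
  have "(1 - \<sigma>) * (w \<bullet> x) + \<sigma> * (w \<bullet> y) > (1 - \<sigma>) * 1 + \<sigma> * 1" if "\<sigma> \<le> 1"
    using that \<sigma> w by (intro add_le_less_mono mult_left_mono mult_strict_left_mono) auto
  with wb wb' have "\<sigma> > 1" by fastforce
  have "y - x = (1 / \<sigma>) *\<^sub>R (b - x)"
    using b \<sigma> by simp
  then have "y = (1 / \<sigma>) *\<^sub>R b + (1 - 1 / \<sigma>) *\<^sub>R x"
    by (simp add: algebra_simps)
  then have "y = (1 - (1 - 1 / \<sigma>)) *\<^sub>R b + (1 - 1 / \<sigma>) *\<^sub>R x" by simp
  moreover have "0 \<le> 1 - 1 / \<sigma>" "1 - 1 / \<sigma> \<le> 1" using \<open>\<sigma> > 1\<close> by auto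
  ultimately have "y \<in> ?S x"
    unfolding convex_hull_cball_insert using bt(2) by blast
  with vertex_not_in_other_spike[OF vertex] xy show False by blast
qed

text \<open>
  A long vertex \<open>x\<close> satisfies \<open>norm x * cos \<alpha> \<ge> 1\<close>, so the open cap of radius \<open>\<alpha>\<close> around its
  direction lies in the half space \<open>w \<bullet> x > 1\<close>, seen as a condition on \<open>w\<close>.
\<close>

lemma card_long_vertices_le:
  fixes X :: "'a::euclidean_space set"
  assumes fin: "finite X" and conv: "convex (Sp X)"
    and vertex: "\<And>x. x \<in> X \<Longrightarrow> Sp X \<noteq> Sp (X - {x})"
    and outside: "\<And>x. x \<in> X \<Longrightarrow> norm x > 1"
  shows "enat (card {x \<in> X. norm x * cos \<alpha> \<ge> 1}) \<le> cap_packing_number TYPE('a) (2 * \<alpha>)"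
proof -
  let ?L = "{x \<in> X. norm x * cos \<alpha> \<ge> 1}"
  note no_common = vertices_not_in_common_half_space[OF fin conv vertex]
  have inner_sgn: "w \<bullet> x = norm x * (sgn x \<bullet> w)" if "x \<in> X" for x w
  proof -
    have "x \<noteq> 0" using outside[OF that] by auto
    then show ?thesis by (simp add: sgn_div_norm inner_commute)
  qed
  have inj: "inj_on sgn ?L"
  proof (rule inj_onI, rule ccontr)
    fix x y assume xy: "x \<in> ?L" "y \<in> ?L" "sgn x = sgn y" "x \<noteq> y"
    have x: "norm (sgn x) = 1" "sgn x \<bullet> sgn x = 1"
      using outside[of x] xy by (auto simp: norm_sgn dot_square_norm)
    show False
      using xy x outside inner_sgn[of x "sgn x"] inner_sgn[of y "sgn x"]
      by (intro no_common[of x y "sgn x"]) auto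
  qed
  have "disjoint_family_on (\<lambda>x. open_cap x (2 * \<alpha> / 2)) (sgn ` ?L)"
    unfolding disjoint_family_on_def
  proof (intro ballI impI equals0I, elim IntE imageE)
    fix a b w x y
    assume ab: "a \<noteq> b" "a = sgn x" "b = sgn y" and xy: "x \<in> ?L" "y \<in> ?L"
      and w: "w \<in> open_cap a (2 * \<alpha> / 2)" "w \<in> open_cap b (2 * \<alpha> / 2)"
    have far: "w \<bullet> v > 1" if "v \<in> ?L" "w \<in> open_cap (sgn v) \<alpha>" for v
    proof -
      have "1 \<le> norm v * cos \<alpha>" using that by simp
      also have "\<dots> < norm v * (sgn v \<bullet> w)"
        using that outside[of v] by (intro mult_strict_left_mono) (auto simp: open_cap_def)
      finally show ?thesis using that inner_sgn[of v w] by simp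
    qed
    show False
      using ab xy w far[of x] far[of y]
      by (intro no_common[of x y w]) (auto simp: open_cap_def)
  qed
  moreover have "sgn ` ?L \<subseteq> sphere 0 1"
    using outside by (fastforce simp: norm_sgn)
  ultimately have "enat (card (sgn ` ?L)) \<le> cap_packing_number TYPE('a) (2 * \<alpha>)"
    unfolding cap_packing_number_def using fin by (intro SUP_upper) auto
  then show ?thesis by (simp add: card_image[OF inj])
qed

section \<open>The bound for one cap body and the maximum\<close>

lemma cap_covering_number_attained:
  assumes "0 < \<theta>" "\<theta> < pi"
  obtains C :: "'a::euclidean_space set"
  where "finite C" "C \<subseteq> sphere 0 1" "sphere 0 1 \<subseteq> (\<Union>c\<in>C. closed_cap c \<theta>)"
    "cap_covering_number TYPE('a) \<theta> = enat (card C)"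
proof -
  let ?A = "{C :: 'a set. finite C \<and> C \<subseteq> sphere 0 1 \<and> sphere 0 1 \<subseteq> (\<Union>x\<in>C. closed_cap x \<theta>)}"
  let ?B = "(\<lambda>C. enat (card C)) ` ?A"
  have "?B \<noteq> {}"
    using cap_covering_number_finite[OF assms, where 'a='a]
    unfolding cap_covering_number_def by (force simp: top_enat_def)
  then have "Inf ?B \<in> ?B"
    unfolding Inf_enat_def by (auto intro: LeastI)
  then show thesis
    using that unfolding cap_covering_number_def by auto
qed

lemma illumination_number_cap_body_le:
  fixes K :: "'a::euclidean_space set"
  assumes \<alpha>: "0 < \<alpha>" "\<alpha> < pi / 2" and K: "cap_body K"
  shows "illumination_number K \<le>
    cap_packing_number TYPE('a) (2 * \<alpha>) + cap_covering_number TYPE('a) (pi / 2 - \<alpha>)"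
proof -
  obtain X where X: "finite X" "X \<noteq> {}" "X \<inter> cball 0 1 = {}" "\<And>x. x \<in> X \<Longrightarrow> Sp X \<noteq> Sp (X - {x})"
    and KX: "K = Sp X" and conv: "convex K" and comp: "compact K"
    using K unfolding cap_body_def spiky_ball_def by auto
  have outside: "norm x > 1" if "x \<in> X" for x
    using X(3) that by (auto simp: disjoint_iff not_le)
  have sub: "cball 0 1 \<subseteq> K"
    unfolding KX Sp_def using X(2) hull_subset[of "cball 0 1 \<union> {_::'a}" convex] by blast
  obtain C :: "'a set" where C: "finite C" "C \<subseteq> sphere 0 1"
      and cover: "sphere 0 1 \<subseteq> (\<Union>c\<in>C. closed_cap c (pi / 2 - \<alpha>))"
      and card_C: "cap_covering_number TYPE('a) (pi / 2 - \<alpha>) = enat (card C)"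
    using cap_covering_number_attained[of "pi / 2 - \<alpha>"] \<alpha> by auto
  define L where "L = {x \<in> X. norm x * cos \<alpha> \<ge> 1}"
  define U where "U = (\<lambda>x. - sgn x) ` L \<union> uminus ` C"
  have sin: "sin \<alpha> > 0" using \<alpha> by (intro sin_gt_zero) auto
  have cos: "cos \<alpha> > 0" using \<alpha> by (intro cos_gt_zero) auto
  have near_center: "\<exists>c\<in>C. c \<bullet> y \<ge> sin \<alpha>" if "norm y = 1" for y
  proof -
    have "y \<in> (\<Union>c\<in>C. closed_cap c (pi / 2 - \<alpha>))"
      using that cover by auto
    then show ?thesis by (auto simp: closed_cap_def cos_diff)
  qed
  have illuminated: "\<exists>u\<in>U. illuminates K u z" if z: "z \<in> frontier K" for z
  proof -
    have "z \<in> K"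
      using z comp by (meson compact_imp_closed frontier_subset_closed subsetD)
    from comp[unfolded KX] X(2) z[unfolded KX] show ?thesis
    proof (cases rule: frontier_Sp_cases)
      case ball
      then obtain c where c: "c \<in> C" "c \<bullet> z \<ge> sin \<alpha>" using near_center by blast
      have "norm (z + (- (z \<bullet> - c)) *\<^sub>R - c) < 1"
        using C c sin ball by (intro ray_meets_ball) (auto simp: inner_commute)
      then have "illuminates K (- c) z"
        using \<open>z \<in> K\<close> sub conv c sin
        by (intro illuminatesI_convex[of K z "c \<bullet> z"] ball_subset_interior_if_cball_subset)
          (auto simp: inner_commute)
      then show ?thesis using c by (auto simp: U_def)
    next
      case (spike x b t)
      show ?thesis
      proof (cases "x \<in> L")
        case True
        have "x + norm x *\<^sub>R - sgn x = 0"
          by (cases "x = 0") (auto simp: sgn_div_norm)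
        then have "norm (x + norm x *\<^sub>R - sgn x) < 1" by (metis norm_zero zero_less_one)
        moreover have "0 < norm x" using outside[OF spike(1)] by linarith
        ultimately have "illuminates K (- sgn x) z"
          using illuminates_along_ray_into_ball[OF conv sub \<open>z \<in> K\<close> spike(2-5)] by blast
        then show ?thesis using True by (auto simp: U_def)
      next
        case False
        then have short: "norm x * cos \<alpha> < 1" using spike by (simp add: L_def)
        have "norm (sgn x) = 1" using outside[OF spike(1)] by (auto simp: norm_sgn)
        then obtain c where c: "c \<in> C" "c \<bullet> sgn x \<ge> sin \<alpha>" using near_center by blast
        have "norm x * sin \<alpha> \<le> norm x * (c \<bullet> sgn x)"
          using c by (intro mult_left_mono) auto
        also have "\<dots> = c \<bullet> x"
          by (cases "x = 0") (auto simp: sgn_div_norm)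
        finally have cx: "norm x * sin \<alpha> \<le> c \<bullet> x" .
        moreover have "0 < norm x * sin \<alpha>"
          using outside[OF spike(1)] sin by (intro mult_pos_pos) auto
        ultimately have pos: "0 < c \<bullet> x" by linarith
        have "(norm x)\<^sup>2 = (norm x * sin \<alpha>)\<^sup>2 + (norm x * cos \<alpha>)\<^sup>2"
          unfolding power_mult_distrib distrib_left[symmetric] by simp
        moreover have "(norm x * sin \<alpha>)\<^sup>2 \<le> (c \<bullet> x)\<^sup>2"
          using cx \<open>0 < norm x * sin \<alpha>\<close> by (intro power_mono) auto
        moreover have "(norm x * cos \<alpha>)\<^sup>2 < 1"
          using short cos by (intro power_less_one_iff[THEN iffD2]) auto
        ultimately have "(norm x)\<^sup>2 - (x \<bullet> - c)\<^sup>2 < 1"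
          by (simp add: inner_commute)
        then have "norm (x + (- (x \<bullet> - c)) *\<^sub>R - c) < 1"
          using C c by (intro ray_meets_ball) auto
        moreover have "0 < - (x \<bullet> - c)" using pos by (simp add: inner_commute)
        ultimately have "illuminates K (- c) z"
          using illuminates_along_ray_into_ball[OF conv sub \<open>z \<in> K\<close> spike(2-5)] by blast
        then show ?thesis using c by (auto simp: U_def)
      qed
    qed
  qed
  have "finite L" using X(1) by (simp add: L_def)
  have "norm (sgn x) = 1" if "x \<in> L" for x
    using outside[of x] that by (auto simp: L_def norm_sgn)
  then have "finite U" "U \<subseteq> sphere 0 1"
    using \<open>finite L\<close> C by (auto simp: U_def)
  then have "illumination_number K \<le> enat (card U)"
    unfolding illumination_number_def using illuminated by (intro INF_lower) auto
  also have "card U \<le> card L + card C"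
    unfolding U_def using \<open>finite L\<close> C
    by (meson add_mono card_Un_le card_image_le order_trans)
  then have "enat (card U) \<le> enat (card L) + enat (card C)" by simp
  also have "\<dots> \<le> cap_packing_number TYPE('a) (2 * \<alpha>) + cap_covering_number TYPE('a) (pi / 2 - \<alpha>)"
    unfolding card_C L_def
    using card_long_vertices_le[OF X(1) _ X(4) outside] conv KX by (intro add_right_mono) auto
  finally show ?thesis .
qed

text \<open>A ball with a single spike is a convex hull, so it is a cap body in every dimension.\<close>

lemma cap_body_exists: "\<exists>K :: 'a::euclidean_space set. cap_body K"
proof -
  obtain e :: 'a where e: "norm e = 1"
    using vector_choose_size[of 1] by auto
  let ?x = "2 *\<^sub>R e"
  let ?K = "convex hull (cball 0 1 \<union> {?x})"
  have K: "Sp {?x} = ?K" by (simp add: Sp_def)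
  have sub: "cball 0 1 \<subseteq> ?K" by (meson Un_subset_iff hull_subset)
  have "Sp ({?x} - {?x}) = {}" by (simp add: Sp_def)
  moreover have "?K \<noteq> {}" using sub by fastforce
  ultimately have "spiky_ball ?K"
    unfolding spiky_ball_def using e K by (intro exI[of _ "{?x}"]) auto
  moreover have "compact ?K" by (intro compact_convex_hull compact_Un) auto
  moreover have "interior ?K \<noteq> {}"
    using ball_subset_interior_if_cball_subset[OF sub, of 0] by auto
  ultimately show ?thesis unfolding cap_body_def using convex_convex_hull by blast
qed

lemma Sup_enat_mem_if_finite: "A \<noteq> {} \<Longrightarrow> Sup A < \<infinity> \<Longrightarrow> Sup A \<in> A" for A :: "enat set"
  unfolding Sup_enat_def by (auto split: if_splits intro: Max_in)

theorem theorem4: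
  fixes \<alpha> :: real
  assumes "0 < \<alpha>" and "\<alpha> < pi / 2"
  shows "(\<exists>K :: 'a::euclidean_space set. cap_body K \<and>
            illumination_number K = cap_body_illumination_number TYPE('a)) \<and>
         cap_body_illumination_number TYPE('a) \<le>
           cap_packing_number TYPE('a) (2 * \<alpha>) + cap_covering_number TYPE('a) (pi / 2 - \<alpha>)"
proof -
  let ?bound = "cap_packing_number TYPE('a) (2 * \<alpha>) + cap_covering_number TYPE('a) (pi / 2 - \<alpha>)"
  let ?A = "illumination_number ` {K :: 'a set. cap_body K}"
  have le: "Sup ?A \<le> ?bound"
    using illumination_number_cap_body_le[OF assms] by (intro SUP_least) auto
  have "cap_packing_number TYPE('a) (2 * \<alpha>) < \<infinity>"
    using assms by (intro cap_packing_number_finite) auto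
  moreover have "cap_covering_number TYPE('a) (pi / 2 - \<alpha>) < \<infinity>"
    using assms by (intro cap_covering_number_finite) auto
  ultimately have "?bound < \<infinity>" by (simp add: plus_eq_infty_iff_enat)
  with le have "Sup ?A < \<infinity>" by (rule order_le_less_trans)
  then have "Sup ?A \<in> ?A"
    using cap_body_exists[where 'a='a] by (intro Sup_enat_mem_if_finite) auto
  with le show ?thesis
    unfolding cap_body_illumination_number_def by force
qed

end
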